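(* Let $n\ge 2$ be an integer, let $\{g_\varepsilon\}_{\varepsilon>0}\subset C^{1,1}(\mathbb{R})$ be an admissible smoothing family, and let $\varepsilon>0$ be fixed. Then $\psi_{n,\varepsilon}$ is of class $C^{1,1}_{loc}(\mathbb{R}^n)$, and for all $i,j\in\{1,\ldots,n\}$ $$\frac{\partial\psi_{n,\varepsilon}}{\partial a_i}(a)=\delta_{i,n}-g_\varepsilon'(a_n-\psi_{n-1,\varepsilon}(a))\left(\delta_{i,n}-\frac{\partial\psi_{n-1,\varepsilon}}{\partial a_i}(a)\right)\quad\text{for all }a\in\mathbb{R}^n,$$ $$\frac{\partial^2\psi_{n,\varepsilon}}{\partial a_i\partial a_j}(a)=-g_\varepsilon''(a_n-\psi_{n-1,\varepsilon}(a))\left(\delta_{i,n}-\frac{\partial\psi_{n-1,\varepsilon}}{\partial a_i}(a)\right)\left(\delta_{j,n}-\frac{\partial\psi_{n-1,\varepsilon}}{\partial a_j}(a)\right)+g_\varepsilon'(a_n-\psi_{n-1,\varepsilon}(a))\frac{\partial^2\psi_{n-1,\varepsilon}}{\partial a_i\partial a_j}(a)$$ for almost all $a\in\mathbb{R}^n$, where $\delta_{i,j}$ is the Kronecker delta. Further, $$\|\psi_{n,\varepsilon}-\psi_n\|_{L^\infty(\mathbb{R}^n)}\le(n-1)\varepsilon,$$ $$\frac{\partial\psi_{n,\varepsilon}}{\partial a_i}(a)\ge 0\ \text{ for all } i\in\{1,\ldots,n\},\qquad\sum_{j=1}^n\frac{\partial\psi_{n,\varepsilon}}{\partial a_j}(a)=1,\qquad\text{for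 all }a\in\mathbb{R}^n,$$ $$-2(n-1)\|g_\varepsilon''\|_{L^\infty(\mathbb{R})}\le b^\top\nabla^2\psi_{n,\varepsilon}(a)\,b\le 0\quad\text{for almost all }a\in\mathbb{R}^n\text{ and all }b\in\mathbb{R}^n\text{ with }|b|=1,$$ and $$|\nabla^2\psi_{n,\varepsilon}(a)|\le 2(n-1)\|g_\varepsilon''\|_{L^\infty(\mathbb{R})}\quad\text{for almost all }a\in\mathbb{R}^n.$$
   Context: $(x)_+=\max\{x,0\}$. A family $\{g_\varepsilon\}_{\varepsilon>0}\subset C^{1,1}(\mathbb{R})$ ($C^1$ functions with Lipschitz derivative) is called an admissible smoothing family if for every $\varepsilon>0$: $g_\varepsilon(x)\ge 0$ and $g_\varepsilon'(x)\in[0,1]$ for all $x\in\mathbb{R}$; $g_\varepsilon''(x)\ge 0$ for almost all $x\in\mathbb{R}$; $\sup_{x\in\mathbb{R}}|(x)_+-g_\varepsilon(x)|\le\varepsilon$; $g_\varepsilon''\in L^\infty(\mathbb{R})$; and, moreover, $g_\varepsilon'\to\chi_{[0,\infty)}$ uniformly on compact subsets of $\mathbb{R}\setminus\{0\}$ as $\varepsilon\to0^+$. For $a\in\mathbb{R}^m$ and $1\le n\le m$, $\psi_n(a)=\min_{i\in\{1,\ldots,n\}}a_i$. The smoothed minimum is defined recursively by $\psi_{1,\varepsilon}(a)=a_1$ and $\psi_{i+1,\varepsilon}(a)=a_{i+1}-g_\varepsilon(a_{i+1}-\psi_{i,\varepsilon}(a))$ for $i\ge 1$; $\psi_{i,\varepsilon}$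 depends only on the first $i$ entries of $a$ and is regarded as a function on $\mathbb{R}^n$ for every $n\ge i$. $|\cdot|$ denotes the Euclidean norm for vectors and the operator norm for matrices. *)

theory Defs
  imports "HOL-Analysis.Analysis" "HOL-Probability.Essential_Supremum"
begin

text \<open>
  The essential supremum norm. Since \<^const>\<open>esssup\<close> is infinite on non-measurable functions,
  \<open>Linf_norm f < \<infinity>\<close> includes Lebesgue measurability of \<open>f\<close>.
\<close>

definition Linf_norm :: "('a::euclidean_space \<Rightarrow> real) \<Rightarrow> ereal" where
  "Linf_norm f = esssup lebesgue (\<lambda>x. ereal \<bar>f x\<bar>)"

definition C11 :: "(real \<Rightarrow> real) \<Rightarrow> bool" where
  "C11 f \<longleftrightarrow> (\<forall>x. f differentiable (at x)) \<and> (\<exists>L. L-lipschitz_on UNIV (deriv f))"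

definition C11_loc :: "('a::real_normed_vector \<Rightarrow> real) \<Rightarrow> bool" where
  "C11_loc f \<longleftrightarrow> (\<exists>f' :: 'a \<Rightarrow> ('a \<Rightarrow>\<^sub>L real).
     (\<forall>x. (f has_derivative blinfun_apply (f' x)) (at x)) \<and>
     (\<forall>x. \<exists>r>0. \<exists>L. L-lipschitz_on (ball x r) f'))"

text \<open>
  The second derivative of \<open>g \<epsilon>\<close> exists only almost everywhere. \<^const>\<open>deriv\<close> is an unspecified
  constant at the remaining points, which form a null set because \<open>deriv (g \<epsilon>)\<close> is Lipschitz.
  The values \<open>g \<epsilon>\<close> for \<open>\<epsilon> \<le> 0\<close> are irrelevant.
\<close>

definition admissible_smoothing :: "(real \<Rightarrow> real \<Rightarrow> real) \<Rightarrow> bool" where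
  "admissible_smoothing g \<longleftrightarrow>
     (\<forall>\<epsilon>>0. C11 (g \<epsilon>) \<and>
        (\<forall>x. g \<epsilon> x \<ge> 0) \<and>
        (\<forall>x. deriv (g \<epsilon>) x \<in> {0..1}) \<and>
        (AE x in lebesgue. deriv (deriv (g \<epsilon>)) x \<ge> 0) \<and>
        (SUP x. ereal \<bar>max x 0 - g \<epsilon> x\<bar>) \<le> ereal \<epsilon> \<and>
        Linf_norm (deriv (deriv (g \<epsilon>))) < \<infinity>) \<and>
     (\<forall>K. compact K \<and> K \<subseteq> UNIV - {0} \<longrightarrow>
        uniform_limit K (\<lambda>\<epsilon>. deriv (g \<epsilon>)) (indicator {0..}) (at_right 0))"

text \<open>
  The coordinates of \<open>a :: real ^ 'n\<close> are enumerated by a bijection \<open>e\<close> from \<open>{1..CARD('n)}\<close>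
  onto \<open>'n\<close>, so that the \<open>i\<close>-th entry of \<open>a\<close> is \<open>a $ e i\<close>. All the functions below are regarded
  as functions on the whole space. The value of \<open>psi_eps\<close> at index 0 is a dummy.
\<close>

definition psi :: "(nat \<Rightarrow> 'n::finite) \<Rightarrow> nat \<Rightarrow> real ^ 'n \<Rightarrow> real" where
  "psi e n a = Min ((\<lambda>i. a $ e i) ` {1..n})"

fun psi_eps :: "(real \<Rightarrow> real) \<Rightarrow> (nat \<Rightarrow> 'n::finite) \<Rightarrow> nat \<Rightarrow> real ^ 'n \<Rightarrow> real" where
  "psi_eps h e 0 a = 0"
| "psi_eps h e (Suc 0) a = a $ e 1"
| "psi_eps h e (Suc (Suc i)) a =
     a $ e (Suc (Suc i)) - h (a $ e (Suc (Suc i)) - psi_eps h e (Suc i) a)"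

definition partial_differentiable :: "'n \<Rightarrow> (real ^ 'n::finite \<Rightarrow> real) \<Rightarrow> real ^ 'n \<Rightarrow> bool" where
  "partial_differentiable k f a \<longleftrightarrow> (\<lambda>t. f (a + t *\<^sub>R axis k 1)) differentiable (at (0::real))"

definition partial_deriv :: "'n \<Rightarrow> (real ^ 'n::finite \<Rightarrow> real) \<Rightarrow> real ^ 'n \<Rightarrow> real" where
  "partial_deriv k f a = deriv (\<lambda>t. f (a + t *\<^sub>R axis k 1)) 0"

definition hessian :: "(real ^ 'n::finite \<Rightarrow> real) \<Rightarrow> real ^ 'n \<Rightarrow> real ^ 'n ^ 'n" where
  "hessian f a = (\<chi> k l. partial_deriv k (partial_deriv l f) a)"

definition kdelta :: "nat \<Rightarrow> nat \<Rightarrow> real" where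
  "kdelta i j = (if i = j then 1 else 0)"

end

theory Submission
  imports Defs
begin

text \<open>
  By the chain rule the gradient of the smoothed minimum of \<open>n\<close> entries is a convex combination of
  the \<open>n\<close>-th unit vector and the gradient for \<open>n - 1\<close> entries; hence it is nonnegative with entries
  summing to 1, and so has norm at most 1. Let \<open>v\<close> be the difference of these two vectors. The
  Hessian for \<open>n\<close> entries is the rank-one matrix \<open>- g'' v v\<^sup>T\<close>, with \<open>|v|\<^sup>2 \<le> 2\<close>, plus a multiple
  \<open>g' \<in> [0,1]\<close> of the Hessian for \<open>n - 1\<close> entries, which gives both bounds by induction.

  The Hessian recursion needs \<open>g'\<close> to be differentiable at the arguments \<open>a\<^sub>k - \<psi>\<^sub>k\<^sub>-\<^sub>1(a)\<close>. A Lipschitz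
  function on the line is differentiable outside a null set, and the points \<open>a\<close> whose argument falls
  into a given null set are again negligible: \<open>\<psi>\<^sub>k\<^sub>-\<^sub>1\<close> does not depend on \<open>a\<^sub>k\<close>, so these points are
  the image of a null set under a Lipschitz shear.
\<close>

section \<open>Lipschitz functions on the line\<close>

text \<open>
  The intervals \<open>[x, x + h]\<close> of small slope form a Vitali cover of \<open>E\<close>; the part of \<open>E\<close> missed by a
  disjoint subfamily has a null image because \<open>F\<close> is Lipschitz.
\<close>

lemma emeasure_image_le_of_small_slopes:
  fixes F :: "real \<Rightarrow> real"
  assumes mono: "strict_mono F" and lip: "K-lipschitz_on UNIV F"
    and E: "E \<in> sets borel" and FE: "F ` E \<in> sets borel" and "p > 0"
    and slope: "\<And>x d. x \<in> E \<Longrightarrow> d > 0 \<Longrightarrow> \<exists>h. h \<noteq> 0 \<and> \<bar>h\<bar> < d \<and> (F (x + h) - F x) / h < p"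
  shows "emeasure lborel (F ` E) \<le> ennreal p * emeasure lborel E"
proof (rule ennreal_le_epsilon)
  fix e :: real
  assume "e > 0"
  \<comment> \<open>The excess of \<open>U\<close> over \<open>E\<close> is multiplied by
    \<open>p\<close> in the end, so the tolerance \<open>e / p\<close> leaves a total error of
    \<open>e\<close>.\<close>
  have "e / p > 0" using \<open>e > 0\<close> \<open>p > 0\<close> by simp
  from outer_regular_lborel_le[OF E this] obtain U
    where U: "open U" "E \<subseteq> U" and UE: "emeasure lborel (U - E) \<le> ennreal (e / p)"
    by blast
  have "emeasure lborel U = emeasure lborel E + emeasure lborel (U - E)"
    using U E by (subst plus_emeasure) (auto simp: Un_absorb1)
  also have "\<dots> \<le> emeasure lborel E + ennreal (e / p)"
    using UE by (intro add_left_mono)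
  finally have U_le: "emeasure lborel U \<le> emeasure lborel E + ennreal (e / p)" .
  \<comment> \<open>Pairs of a centre and a radius: the interval with endpoints \<open>x\<close> and
    \<open>x + h\<close> becomes the ball around \<open>x + h / 2\<close> of radius
    \<open>|h| / 2\<close>, the form in which the Vitali theorem takes its cover.\<close>
  define I where "I = {(c, r). r > 0 \<and> cball c r \<subseteq> U \<and> F (c + r) - F (c - r) < p * (2 * r)}"
  have cover: "\<exists>i. i \<in> I \<and> x \<in> cball (fst i) (snd i) \<and> snd i < d" if x: "x \<in> E" and d: "d > 0" for x d
  proof -
    have "x \<in> U" using U(2) x by blast
    then obtain s where s: "s > 0" "cball x s \<subseteq> U"
      using open_contains_cball_eq[OF U(1)] by auto
    obtain h where h: "h \<noteq> 0" "\<bar>h\<bar> < min s d" "(F (x + h) - F x) / h < p"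
      using slope[OF x, of "min s d"] s(1) d by auto
    have "cball (x + h / 2) (\<bar>h\<bar> / 2) \<subseteq> cball x s"
      using h by (auto simp: dist_real_def abs_if split: if_splits)
    moreover have "F (x + h / 2 + \<bar>h\<bar> / 2) - F (x + h / 2 - \<bar>h\<bar> / 2) < p * (2 * (\<bar>h\<bar> / 2))"
    proof (cases "h > 0")
      case True
      then have "x + h / 2 + \<bar>h\<bar> / 2 = x + h" "x + h / 2 - \<bar>h\<bar> / 2 = x" by (auto simp: field_simps)
      then show ?thesis using h True by (simp only:) (simp add: field_simps)
    next
      case False
      then have "x + h / 2 + \<bar>h\<bar> / 2 = x" "x + h / 2 - \<bar>h\<bar> / 2 = x + h" by (auto simp: field_simps)
      then show ?thesis using h False by (simp only:) (simp add: field_simps)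
    qed
    ultimately have "(x + h / 2, \<bar>h\<bar> / 2) \<in> I"
      using h s by (auto simp: I_def)
    then show ?thesis
      using h by (intro exI[of _ "(x + h / 2, \<bar>h\<bar> / 2)"]) (auto simp: dist_real_def)
  qed
  have Ipos0: "snd i > 0" if "i \<in> I" for i
    using that by (auto simp: I_def)
  obtain C where C: "countable C" "C \<subseteq> I"
    "pairwise (\<lambda>i j. disjnt (cball (fst i) (snd i)) (cball (fst j) (snd j))) C"
    "negligible (E - (\<Union>i\<in>C. cball (fst i) (snd i)))"
    using Vitali_covering_theorem_cballs[of I snd E fst, OF _ cover] Ipos0 by blast
  define N where "N = E - (\<Union>i\<in>C. cball (fst i) (snd i))"
  define J where "J i = {F (fst i - snd i)..F (fst i + snd i)}" for i
  have Ipos: "snd i > 0" if "i \<in> C" for i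
    using that C by (auto simp: I_def)
  have disj: "disjoint_family_on (\<lambda>i. cball (fst i) (snd i)) C"
    using C(3) by (simp add: disjoint_family_on_def pairwise_def disjnt_def)
  have disjJ: "disjoint_family_on J C"
    unfolding disjoint_family_on_def
  proof (intro ballI impI)
    fix i j assume ij: "i \<in> C" "j \<in> C" "i \<noteq> j"
    have "cball (fst i) (snd i) \<inter> cball (fst j) (snd j) = {}"
      using disj ij unfolding disjoint_family_on_def by blast
    \<comment> \<open>Two closed intervals that meet share the larger of their left endpoints, so
      its absence from the intersection puts one interval strictly before the other.\<close>
    then have "max (fst i - snd i) (fst j - snd j)
        \<notin> {fst i - snd i..fst i + snd i} \<inter> {fst j - snd j..fst j + snd j}"
      unfolding cball_eq_atLeastAtMost by blast
    then have "fst i + snd i < fst j - snd j \<or> fst j + snd j < fst i - snd i"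
      using Ipos[OF ij(1)] Ipos[OF ij(2)] by (simp add: max_def split: if_splits)
    then have "F (fst i + snd i) < F (fst j - snd j) \<or> F (fst j + snd j) < F (fst i - snd i)"
      using strict_monoD[OF mono] by blast
    then show "J i \<inter> J j = {}"
      by (auto simp: J_def)
  qed
  have "negligible (F ` N)"
  proof (rule negligible_locally_Lipschitz_image)
    show "negligible N" using C by (simp add: N_def)
    show "\<exists>T B. open T \<and> x \<in> T \<and> (\<forall>y\<in>N \<inter> T. norm (F y - F x) \<le> B * norm (y - x))" for x
      using lipschitz_onD[OF lip] by (intro exI[of _ UNIV] exI[of _ K]) (auto simp: dist_norm)
  qed simp
  then have N: "F ` N \<in> null_sets lebesgue"
    by (simp add: negligible_iff_null_sets)
  have JB: "(\<Union>i\<in>C. J i) \<in> sets borel"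
    using C(1) by (intro sets.countable_UN') (auto simp: J_def)
  then have JU: "(\<Union>i\<in>C. J i) \<in> sets lebesgue"
    by simp
  have "F ` E \<subseteq> F ` N \<union> (\<Union>i\<in>C. J i)"
  proof
    fix y assume "y \<in> F ` E"
    then obtain x where x: "x \<in> E" "y = F x" by auto
    show "y \<in> F ` N \<union> (\<Union>i\<in>C. J i)"
    proof (cases "x \<in> N")
      case False
      then obtain i where i: "i \<in> C" "x \<in> cball (fst i) (snd i)" using x by (auto simp: N_def)
      then have "y \<in> J i"
        using x strict_mono_less_eq[OF mono] unfolding J_def cball_eq_atLeastAtMost by simp
      then show ?thesis using i by auto
    qed (use x in auto)
  qed
  \<comment> \<open>The image of \<open>N\<close> is only known to be null for the completed
    measure, hence the passage through \<open>lebesgue\<close>. The union of the \<open>J i\<close>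
    is Borel, and there both measures agree.\<close>
  then have "emeasure lebesgue (F ` E) \<le> emeasure lebesgue (F ` N \<union> (\<Union>i\<in>C. J i))"
    using N JU by (intro emeasure_mono) auto
  also have "\<dots> = emeasure lebesgue (\<Union>i\<in>C. J i)"
    using emeasure_Un_null_set[OF JU N] by (simp only: Un_commute)
  also have "\<dots> = emeasure lborel (\<Union>i\<in>C. J i)"
    using JB by (simp add: main_part)
  also have "\<dots> = (\<integral>\<^sup>+i. emeasure lborel (J i) \<partial>count_space C)"
    using C(1) by (intro emeasure_UN_countable disjJ) (auto simp: J_def)
  also have "\<dots> \<le> (\<integral>\<^sup>+i. ennreal p * emeasure lborel (cball (fst i) (snd i)) \<partial>count_space C)"
  proof (rule nn_integral_mono)
    fix i assume "i \<in> space (count_space C)"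
    then have i: "i \<in> I" "snd i > 0" using C Ipos by auto
    have "emeasure lborel (J i) = ennreal (F (fst i + snd i) - F (fst i - snd i))"
      unfolding J_def using i strict_mono_less_eq[OF mono] by simp
    also have "\<dots> \<le> ennreal (p * (2 * snd i))"
      using i by (intro ennreal_leI) (auto simp: I_def)
    also have "\<dots> = ennreal p * emeasure lborel (cball (fst i) (snd i))"
      unfolding cball_eq_atLeastAtMost using i \<open>p > 0\<close> by (simp add: ennreal_mult)
    finally show "emeasure lborel (J i) \<le> ennreal p * emeasure lborel (cball (fst i) (snd i))" .
  qed
  also have "\<dots> = ennreal p * emeasure lborel (\<Union>i\<in>C. cball (fst i) (snd i))"
    using C(1) disj by (subst emeasure_UN_countable) (auto simp: nn_integral_cmult)
  also have "\<dots> \<le> ennreal p * emeasure lborel U"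
  proof -
    have "cball (fst i) (snd i) \<subseteq> U" if "i \<in> C" for i
    proof -
      have "i \<in> I" using that C(2) by blast
      then show ?thesis unfolding I_def case_prod_beta by blast
    qed
    then have "(\<Union>i\<in>C. cball (fst i) (snd i)) \<subseteq> U" by (rule UN_least)
    then show ?thesis using U(1) by (intro mult_left_mono emeasure_mono) auto
  qed
  also have "\<dots> \<le> ennreal p * (emeasure lborel E + ennreal (e / p))"
    by (intro mult_left_mono U_le) auto
  also have "\<dots> = ennreal p * emeasure lborel E + ennreal e"
    using \<open>p > 0\<close> \<open>e > 0\<close> by (simp add: distrib_left flip: ennreal_mult)
  finally show "emeasure lborel (F ` E) \<le> ennreal p * emeasure lborel E + ennreal e"
    using FE by simp
qed

text \<open>For fixed nonzero \<open>h\<close> the condition on \<open>x\<close> is open, and so is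
  its union over all small \<open>h\<close>. Restricting \<open>d\<close> to the values
  \<open>1 / (m + 1)\<close> turns the set into a countable intersection of open sets.\<close>

lemma borel_small_slopes:
  fixes F :: "real \<Rightarrow> real"
  assumes "continuous_on UNIV F"
  shows "{x. \<forall>d>0. \<exists>h. h \<noteq> 0 \<and> \<bar>h\<bar> < d \<and> (F (x + h) - F x) / h < p} \<in> sets borel"
proof -
  have "{x. \<forall>d>0. \<exists>h. h \<noteq> 0 \<and> \<bar>h\<bar> < d \<and> (F (x + h) - F x) / h < p} =
    (\<Inter>m. \<Union>h\<in>{h. h \<noteq> 0 \<and> \<bar>h\<bar> < inverse (real (Suc m))}. {x. (F (x + h) - F x) / h < p})"
    (is "?A = ?B")
  proof (intro equalityI subsetI)
    fix x assume "x \<in> ?A" then show "x \<in> ?B" by (auto simp del: of_nat_Suc)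
  next
    fix x assume x: "x \<in> ?B"
    show "x \<in> ?A"
    proof (intro CollectI allI impI)
      fix d :: real assume "d > 0"
      then obtain m where "inverse (real (Suc m)) < d" using reals_Archimedean by blast
      with x show "\<exists>h. h \<noteq> 0 \<and> \<bar>h\<bar> < d \<and> (F (x + h) - F x) / h < p"
        by (auto simp del: of_nat_Suc) (meson less_trans)
    qed
  qed
  moreover have "open {x. (F (x + h) - F x) / h < p}" if "h \<noteq> 0" for h
    using that by (intro open_Collect_less continuous_intros continuous_on_compose2[OF assms]) auto
  then have "(\<Union>h\<in>{h. h \<noteq> 0 \<and> \<bar>h\<bar> < inverse (real (Suc m))}. {x. (F (x + h) - F x) / h < p}) \<in> sets borel"
    for m by (intro borel_open open_UN) auto
  then have "?B \<in> sets borel"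
    by (intro sets.countable_INT) blast+
  ultimately show ?thesis
    by simp
qed

text \<open>
  If \<open>E\<close> is a bounded part of the set, then \<open>|F E| \<le> p |E|\<close>; large slopes of \<open>F\<close> are small slopes of
  its inverse \<open>G\<close>, so also \<open>|E| \<le> |F E| / q\<close>. As \<open>p < q\<close>, this forces \<open>|E| = 0\<close>.
\<close>

lemma null_set_oscillating_slopes:
  fixes F G :: "real \<Rightarrow> real"
  assumes mono: "strict_mono F" and lip: "K-lipschitz_on UNIV F"
    and inv: "\<And>x. G (F x) = x" "\<And>y. F (G y) = y" and lipG: "K'-lipschitz_on UNIV G"
    and pq: "0 < p" "p < q"
  shows "{x. (\<forall>d>0. \<exists>h. h \<noteq> 0 \<and> \<bar>h\<bar> < d \<and> (F (x + h) - F x) / h < p) \<and>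
    (\<forall>d>0. \<exists>h. h \<noteq> 0 \<and> \<bar>h\<bar> < d \<and> (F (x + h) - F x) / h > q)} \<in> null_sets lborel"
    (is "?D \<in> _")
proof -
  have cF: "continuous_on UNIV F" and cG: "continuous_on UNIV G"
    using lip lipG by (auto intro: lipschitz_on_continuous_on)
  have monoG: "strict_mono G"
    using mono inv by (metis strict_monoI strict_mono_less)
  have "{x. \<forall>d>0. \<exists>h. h \<noteq> 0 \<and> \<bar>h\<bar> < d \<and> (F (x + h) - F x) / h > q} \<in> sets borel"
  proof -
    have "(- F (x + h) - - F x) / h < - q \<longleftrightarrow> (F (x + h) - F x) / h > q" for x h
      by (simp add: diff_divide_distrib) linarith
    then show ?thesis
      using borel_small_slopes[of "\<lambda>x. - F x" "- q"] cF by (simp only: continuous_on_minus)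
  qed
  from sets.Int[OF borel_small_slopes[OF cF, of p] this]
  have D: "?D \<in> sets borel"
    by (simp only: Collect_conj_eq)
  have "?D \<inter> {- real k..real k} \<in> null_sets lborel" for k :: nat
  proof -
    define E where "E = ?D \<inter> {- real k..real k}"
    have E: "E \<in> sets borel" using D by (auto simp: E_def)
    \<comment> \<open>The image is a preimage under the continuous inverse, which makes it
      Borel.\<close>
    have "F ` E = G -` E \<inter> space borel"
      using inv by (auto simp: image_iff) metis
    then have FE: "F ` E \<in> sets borel"
      using E cG by (metis borel_measurable_continuous_onI measurable_sets)
    have GFE: "G ` F ` E = E"
      using inv by (auto simp: image_image)
    have 1: "emeasure lborel (F ` E) \<le> ennreal p * emeasure lborel E"
      by (rule emeasure_image_le_of_small_slopes[OF mono lip E FE pq(1)]) (auto simp: E_def)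
    have 2: "emeasure lborel (G ` F ` E) \<le> ennreal (1 / q) * emeasure lborel (F ` E)"
    proof (rule emeasure_image_le_of_small_slopes[OF monoG lipG FE])
      show "G ` F ` E \<in> sets borel" using E GFE by simp
      show "1 / q > 0" using pq by simp
      fix y d :: real
      assume "y \<in> F ` E" "d > 0"
      then obtain x where x: "x \<in> E" "y = F x" by auto
      \<comment> \<open>Adding 1 makes the constant positive, so that \<open>d / K1\<close> is a
        valid step bound. A step of \<open>F\<close> in \<open>x\<close> shorter than
        \<open>d / K1\<close> is then a step of \<open>G\<close> in \<open>y = F x\<close> shorter
        than \<open>d\<close>, with reciprocal slope.\<close>
      define K1 where "K1 = K + 1"
      have K: "K1 > 0" using lipschitz_on_nonneg[OF lip] by (simp add: K1_def)
      then obtain h where h: "h \<noteq> 0" "\<bar>h\<bar> < d / K1" "(F (x + h) - F x) / h > q"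
        using x \<open>d > 0\<close> by (auto simp: E_def dest!: spec[of _ "d / K1"])
      define k where "k = F (x + h) - F x"
      have "\<bar>k\<bar> \<le> K1 * \<bar>h\<bar>"
        using lipschitz_onD[OF lip, of "x + h" x] K by (auto simp: k_def dist_real_def K1_def algebra_simps)
      also have "\<dots> < d" using h K by (auto simp: field_simps)
      finally have kd: "\<bar>k\<bar> < d" .
      have kh: "k / h > q" using h by (simp add: k_def)
      then have "k \<noteq> 0" using pq by auto
      have "h / k = 1 / (k / h)" by simp
      also have "\<dots> < 1 / q" using kh pq by (intro divide_strict_left_mono) (auto intro!: mult_pos_pos simp del: times_divide_eq_left)
      finally have "h / k < 1 / q" .
      moreover have "G (y + k) - G y = h" using inv x by (simp add: k_def)
      ultimately show "\<exists>h. h \<noteq> 0 \<and> \<bar>h\<bar> < d \<and> (G (y + h) - G y) / h < 1 / q"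
        using kd \<open>k \<noteq> 0\<close> by auto
    qed
    \<comment> \<open>Boundedness of \<open>E\<close> makes its measure a real number
      \<open>m\<close>, so that \<open>m \<le> (p / q) * m\<close> with \<open>p < q\<close> gives
      \<open>m = 0\<close>.\<close>
    have "emeasure lborel E \<le> emeasure lborel {- real k..real k}"
      by (rule emeasure_mono) (auto simp: E_def)
    then have "emeasure lborel E \<noteq> \<infinity>" by (auto simp: top_unique)
    then obtain m where m: "emeasure lborel E = ennreal m" "m \<ge> 0"
      by (cases "emeasure lborel E") auto
    have "emeasure lborel E \<le> ennreal (1 / q) * (ennreal p * emeasure lborel E)"
      using 1 2 GFE by (metis mult_left_mono order_trans zero_le)
    also have "\<dots> = ennreal (1 / q * (p * m))"
      using pq m by (simp only: ennreal_mult divide_nonneg_nonneg mult_nonneg_nonneg less_imp_le zero_le_one)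
    finally have "ennreal m \<le> ennreal (1 / q * (p * m))"
      using m by simp
    then have "m \<le> 1 / q * (p * m)"
      using pq m by (subst (asm) ennreal_le_iff) auto
    then have "q * m \<le> p * m" using pq by (simp add: field_simps)
    then have "m = 0" using pq m by (metis linorder_not_less mult_le_cancel_right order_antisym_conv)
    then show ?thesis using E m by (auto simp: E_def intro!: null_setsI)
  qed
  then have "(\<Union>k. ?D \<inter> {- real k..real k}) \<in> null_sets lborel" by blast
  moreover have "(\<Union>k. ?D \<inter> {- real k..real k}) = ?D"
  proof -
    have "(\<Union>k. {- real k..real k}) = UNIV"
    proof -
      have "\<exists>k. x \<in> {- real k..real k}" for x
        using real_arch_simple[of "\<bar>x\<bar>"] by (auto simp: abs_le_iff minus_le_iff)
      then show ?thesis by blast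
    qed
    then show ?thesis by blast
  qed
  ultimately show ?thesis by simp
qed

text \<open>The difference quotients at \<open>x\<close> lie between 1 and \<open>K\<close>, so
  their lower and upper limits at 0 are finite. If these differed, two rationals between them would
  contradict \<open>osc\<close>; hence they agree and are the derivative.\<close>

lemma differentiable_if_not_oscillating:
  fixes F :: "real \<Rightarrow> real"
  assumes lip: "K-lipschitz_on UNIV F" and slope: "\<And>x y. x \<le> y \<Longrightarrow> y - x \<le> F y - F x"
    and osc: "\<And>p q. p \<in> \<rat> \<Longrightarrow> q \<in> \<rat> \<Longrightarrow> 0 < p \<Longrightarrow> p < q \<Longrightarrow>
      \<not> ((\<forall>d>0. \<exists>h. h \<noteq> 0 \<and> \<bar>h\<bar> < d \<and> (F (x + h) - F x) / h < p) \<and>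
         (\<forall>d>0. \<exists>h. h \<noteq> 0 \<and> \<bar>h\<bar> < d \<and> (F (x + h) - F x) / h > q))"
  shows "F differentiable (at x)"
proof -
  define Q where "Q h = ereal ((F (x + h) - F x) / h)" for h
  have freq: "(\<exists>\<^sub>F h in at 0. P h) \<longleftrightarrow> (\<forall>d>0. \<exists>h. h \<noteq> 0 \<and> \<bar>h\<bar> < d \<and> P h)" for P :: "real \<Rightarrow> bool"
    unfolding frequently_def eventually_at by (auto simp: dist_real_def)
  have lo: "1 \<le> Q h" if "h \<noteq> 0" for h
    using slope[of x "x + h"] slope[of "x + h" x] that
    by (cases "h > 0") (auto simp: Q_def field_simps)
  have hi: "Q h \<le> ereal K" if "h \<noteq> 0" for h
    using lipschitz_onD[OF lip, of "x + h" x] that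
    by (cases "h > 0") (auto simp: Q_def field_simps dist_real_def)
  define l where "l = Liminf (at 0) Q"
  define u where "u = Limsup (at 0) Q"
  have l1: "1 \<le> l"
    unfolding l_def by (rule Liminf_bounded) (auto simp: eventually_at_filter lo)
  have uK: "u \<le> ereal K"
    unfolding u_def by (rule Limsup_bounded) (auto simp: eventually_at_filter hi)
  have "l \<le> u" unfolding l_def u_def by (rule Liminf_le_Limsup) simp
  have "\<not> l < u"
  proof
    assume "l < u"
    \<comment> \<open>The reals \<open>r < p0 < s\<close> between the two limits leave room for
      rationals \<open>p\<close> in \<open>(r, p0)\<close> and \<open>q\<close> in
      \<open>(p0, s)\<close>.\<close>
    then obtain p0 where p0: "l < ereal p0" "ereal p0 < u" using ereal_dense2 by blast
    obtain r where r: "l < ereal r" "r < p0" using p0 ereal_dense2[of l "ereal p0"] by auto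
    obtain s where s: "p0 < s" "ereal s < u" using p0 ereal_dense2[of "ereal p0" u] by auto
    obtain p where p: "p \<in> \<rat>" "r < p" "p < p0" using Rats_dense_in_real r by blast
    obtain q where q: "q \<in> \<rat>" "p0 < q" "q < s" using Rats_dense_in_real s by blast
    have "l < ereal p" using r p by (metis less_ereal.simps(1) less_trans)
    moreover have "ereal q < u" using q s by (metis less_ereal.simps(1) less_trans)
    moreover have "0 < p" using l1 \<open>l < ereal p\<close>
      by (metis ereal_less(2) le_less_trans less_trans one_ereal_def less_ereal.simps(1) zero_less_one)
    \<comment> \<open>If \<open>Q\<close> were eventually at least \<open>p\<close>, its lower limit
      would be at least \<open>p\<close> as well. The upper limit is treated in the same
      way.\<close>
    moreover have "\<exists>\<^sub>F h in at 0. Q h < ereal p"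
      using \<open>l < ereal p\<close> unfolding l_def frequently_def
      by (metis (mono_tags, lifting) Liminf_bounded eventually_mono leD not_le)
    moreover have "\<exists>\<^sub>F h in at 0. Q h > ereal q"
      using \<open>ereal q < u\<close> unfolding u_def frequently_def
      by (metis (mono_tags, lifting) Limsup_bounded eventually_mono leD not_le)
    ultimately show False
      using osc[of p q] p q unfolding freq Q_def by auto
  qed
  with \<open>l \<le> u\<close> have "l = u" by auto
  obtain D where D: "u = ereal D"
    using l1 uK \<open>l = u\<close> by (cases u) auto
  have "(Q \<longlongrightarrow> u) (at 0)"
    using \<open>l = u\<close> unfolding l_def u_def by (intro Liminf_eq_Limsup) auto
  then have "((\<lambda>h. (F (x + h) - F x) / h) \<longlongrightarrow> D) (at 0)"
    unfolding D Q_def by simp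
  then have "(F has_real_derivative D) (at x)" by (simp add: DERIV_def)
  then show ?thesis using real_differentiable_def by blast
qed

text \<open>Rademacher's theorem in dimension one. Only rational pairs \<open>p < q\<close> have to
  be excluded, so the bad points form a countable union of null sets.\<close>

lemma lipschitz_differentiable_AE:
  fixes f :: "real \<Rightarrow> real"
  assumes "L-lipschitz_on UNIV f"
  shows "AE x in lborel. f differentiable (at x)"
proof -
  \<comment> \<open>The linear term makes \<open>F\<close> invertible with Lipschitz inverse.\<close>
  define F where "F x = f x + (L + 1) * x" for x
  have L: "L \<ge> 0" by (rule lipschitz_on_nonneg[OF assms])
  have fL: "\<bar>f y - f x\<bar> \<le> L * \<bar>y - x\<bar>" for x y
    using lipschitz_onD[OF assms, of y x] by (simp add: dist_real_def)
  have lip: "(L + (L + 1) * 1)-lipschitz_on UNIV F"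
    unfolding F_def using L by (intro lipschitz_intros assms) auto
  have slope: "y - x \<le> F y - F x" if "x \<le> y" for x y
    using fL[of x y] that by (auto simp: F_def abs_if algebra_simps split: if_splits)
  have mono: "strict_mono F"
    using slope by (intro strict_monoI) (smt (verit))
  have cont: "continuous_on UNIV F" by (rule lipschitz_on_continuous_on[OF lip])
  have "\<exists>x. F x = y" for y
  proof -
    \<comment> \<open>Since \<open>F\<close> grows at least at unit rate,
      \<open>F (-t) \<le> y \<le> F t\<close> for this \<open>t\<close>, and the intermediate value
      theorem applies.\<close>
    define t where "t = \<bar>y - F 0\<bar>"
    have "\<exists>x. - t \<le> x \<and> x \<le> t \<and> F x = y"
      using slope[of 0 t] slope[of "-t" 0]
      by (intro IVT' continuous_on_subset[OF cont]) (auto simp: t_def abs_if split: if_splits)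
    then show ?thesis by auto
  qed
  then obtain G where FG: "F (G y) = y" for y by metis
  have GF: "G (F x) = x" for x using FG[of "F x"] strict_mono_eq[OF mono] by simp
  have "1-lipschitz_on UNIV G"
  proof (rule lipschitz_onI)
    show "dist (G x) (G y) \<le> 1 * dist x y" for x y
      using slope[of "G x" "G y"] slope[of "G y" "G x"] FG[of x] FG[of y] by (auto simp: dist_real_def abs_if)
  qed simp
  then have null: "{x. (\<forall>d>0. \<exists>h. h \<noteq> 0 \<and> \<bar>h\<bar> < d \<and> (F (x + h) - F x) / h < p) \<and>
      (\<forall>d>0. \<exists>h. h \<noteq> 0 \<and> \<bar>h\<bar> < d \<and> (F (x + h) - F x) / h > q)} \<in> null_sets lborel"
    if "0 < p" "p < q" for p q
    using null_set_oscillating_slopes[OF mono lip GF FG] that by blast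
  have ae: "AE x in lborel. \<forall>p\<in>\<rat>. \<forall>q\<in>\<rat>. 0 < p \<longrightarrow> p < q \<longrightarrow>
      \<not> ((\<forall>d>0. \<exists>h. h \<noteq> 0 \<and> \<bar>h\<bar> < d \<and> (F (x + h) - F x) / h < p) \<and>
         (\<forall>d>0. \<exists>h. h \<noteq> 0 \<and> \<bar>h\<bar> < d \<and> (F (x + h) - F x) / h > q))"
    using AE_not_in[OF null] by (simp add: AE_ball_countable countable_rat)
  show ?thesis using ae
  proof eventually_elim
    case (elim x)
    have "F differentiable (at x)"
      by (rule differentiable_if_not_oscillating[OF lip slope]) (use elim in blast)+
    then have "(\<lambda>y. F y - (L + 1) * y) differentiable (at x)"
      by (intro derivative_intros) auto
    then show ?case by (simp add: F_def)
  qed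
qed

section \<open>Null sets under shears\<close>

text \<open>In coordinates the set is a product with one factor \<open>N\<close> and all others the
  whole line. Its measure is a product with a factor 0, which is 0 even if other factors are
  infinite.\<close>

lemma null_set_inner_Basis:
  fixes b :: "'a::euclidean_space"
  assumes N: "N \<in> null_sets lborel" and b: "b \<in> Basis"
  shows "{a. a \<bullet> b \<in> N} \<in> null_sets lborel"
proof -
  interpret product_sigma_finite "\<lambda>_::'a. lborel :: real measure" by standard
  have [measurable]: "N \<in> sets borel" using N by auto
  have S: "{a. a \<bullet> b \<in> N} \<in> sets borel" by measurable
  define M where "M = (\<Pi>\<^sub>M i\<in>(Basis::'a set). (lborel :: real measure))"
  have meas: "(\<lambda>f. \<Sum>i\<in>Basis. f i *\<^sub>R i) \<in> measurable M (borel :: 'a measure)"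
    unfolding M_def by measurable
  have "(\<Sum>i\<in>Basis. f i *\<^sub>R i) \<bullet> b = f b" for f :: "'a \<Rightarrow> real"
    using b by (simp add: inner_sum_left_Basis)
  then have pre: "(\<lambda>f. \<Sum>i\<in>Basis. f i *\<^sub>R i) -` {a. a \<bullet> b \<in> N} \<inter> space M =
      PiE Basis (\<lambda>i. if i = b then N else UNIV)"
    using b by (auto simp: M_def space_PiM PiE_iff split: if_splits)
  have "emeasure lborel {a. a \<bullet> b \<in> N} =
      emeasure (distr M borel (\<lambda>f. \<Sum>i\<in>Basis. f i *\<^sub>R i)) {a. a \<bullet> b \<in> N}"
    unfolding M_def by (subst lborel_eq) simp
  also have "\<dots> = emeasure M (PiE Basis (\<lambda>i. if i = b then N else UNIV))"
    by (subst emeasure_distr[OF meas S]) (simp only: pre)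
  also have "\<dots> = (\<Prod>i\<in>Basis. emeasure lborel (if i = b then N else UNIV))"
    unfolding M_def by (rule emeasure_PiM) auto
  also have "\<dots> = 0"
    using N b by (intro prod_zero) (auto intro!: bexI[of _ b])
  finally show ?thesis using S by (auto intro: null_setsI)
qed

text \<open>Because \<open>f\<close> is constant along \<open>b\<close>, subtracting
  \<open>f(a) b\<close> from \<open>a\<close> undoes the shear \<open>T\<close>. The set is
  therefore contained in the image of a null cylinder under the Lipschitz map
  \<open>T\<close>.\<close>

lemma negligible_shear:
  fixes b :: "'a::euclidean_space" and f :: "'a \<Rightarrow> real"
  assumes lip: "L-lipschitz_on UNIV f" and b: "b \<in> Basis"
    and shift: "\<And>a t. f (a + t *\<^sub>R b) = f a" and N: "N \<in> null_sets lborel"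
  shows "negligible {a. a \<bullet> b - f a \<in> N}"
proof -
  define T where "T a = a + f a *\<^sub>R b" for a
  have lipT: "(1 + L * norm b)-lipschitz_on UNIV T"
    unfolding T_def
  proof (intro lipschitz_on_add lipschitz_on_id)
    show "(L * norm b)-lipschitz_on UNIV (\<lambda>a. f a *\<^sub>R b)"
    proof (rule lipschitz_onI)
      show "dist (f x *\<^sub>R b) (f y *\<^sub>R b) \<le> L * norm b * dist x y" for x y
        using lipschitz_onD[OF lip, of x y] b by (simp add: dist_norm flip: scaleR_diff_left)
    qed (use lipschitz_on_nonneg[OF lip] in simp)
  qed
  have "negligible {a. a \<bullet> b \<in> N}"
    using null_set_inner_Basis[OF N b] by (simp add: negligible_iff_null_sets null_sets_completionI)
  then have "negligible (T ` {a. a \<bullet> b \<in> N})"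
  proof (rule negligible_locally_Lipschitz_image[rotated])
    show "\<exists>U B. open U \<and> x \<in> U \<and> (\<forall>y\<in>{a. a \<bullet> b \<in> N} \<inter> U. norm (T y - T x) \<le> B * norm (y - x))" for x
      using lipschitz_onD[OF lipT] by (intro exI[of _ UNIV] exI[of _ "1 + L * norm b"]) (auto simp: dist_norm)
  qed simp
  moreover have "{a. a \<bullet> b - f a \<in> N} \<subseteq> T ` {a. a \<bullet> b \<in> N}"
  proof
    fix a assume a: "a \<in> {a. a \<bullet> b - f a \<in> N}"
    have "f (a - f a *\<^sub>R b) = f a" using shift[of a "- f a"] by simp
    then have "T (a - f a *\<^sub>R b) = a" by (simp add: T_def)
    moreover have "(a - f a *\<^sub>R b) \<bullet> b \<in> N" using a b by (simp add: inner_diff_left inner_Basis)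
    ultimately show "a \<in> T ` {a. a \<bullet> b \<in> N}" by (metis image_eqI mem_Collect_eq)
  qed
  ultimately show ?thesis by (rule negligible_subset)
qed

lemma AE_shear:
  fixes b :: "'a::euclidean_space" and f :: "'a \<Rightarrow> real"
  assumes "L-lipschitz_on UNIV f" "b \<in> Basis" "\<And>a t. f (a + t *\<^sub>R b) = f a"
    and "AE t in lborel. P t"
  shows "AE a in lebesgue. P (a \<bullet> b - f a)"
proof -
  obtain N where N: "{t. \<not> P t} \<subseteq> N" "N \<in> null_sets lborel"
    using assms(4) unfolding eventually_ae_filter by auto
  have "{a. a \<bullet> b - f a \<in> N} \<in> null_sets lebesgue"
    using negligible_shear[OF assms(1-3) N(2)] by (simp add: negligible_iff_null_sets)
  then show ?thesis
    by (rule AE_I') (use N in auto)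
qed

section \<open>Derivatives of the smoothed minimum\<close>

text \<open>The formal derivative of the recursion of \<open>psi_eps\<close>. An explicit recursion
  allows sign, sum and Lipschitz bounds to be proved by induction.\<close>

fun psi_grad :: "(real \<Rightarrow> real) \<Rightarrow> (nat \<Rightarrow> 'n::finite) \<Rightarrow> nat \<Rightarrow> real ^ 'n \<Rightarrow> real ^ 'n" where
  "psi_grad h e 0 a = 0"
| "psi_grad h e (Suc 0) a = axis (e 1) 1"
| "psi_grad h e (Suc (Suc i)) a = axis (e (Suc (Suc i))) 1
     - deriv h (a $ e (Suc (Suc i)) - psi_eps h e (Suc i) a)
       *\<^sub>R (axis (e (Suc (Suc i))) 1 - psi_grad h e (Suc i) a)"

text \<open>The formal second derivative, a total function. It has the meaning of a Hessian only
  where \<open>deriv h\<close> is differentiable at all arguments that occur; elsewhere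
  \<open>deriv (deriv h)\<close> may be an arbitrary value.\<close>

fun psi_hess :: "(real \<Rightarrow> real) \<Rightarrow> (nat \<Rightarrow> 'n::finite) \<Rightarrow> nat \<Rightarrow> real ^ 'n \<Rightarrow> real ^ 'n ^ 'n" where
  "psi_hess h e 0 a = 0"
| "psi_hess h e (Suc 0) a = 0"
| "psi_hess h e (Suc (Suc i)) a = (let m = e (Suc (Suc i)); u = a $ m - psi_eps h e (Suc i) a;
       v = axis m 1 - psi_grad h e (Suc i) a in
     (\<chi> k l. - deriv (deriv h) u * v $ k * v $ l + deriv h u * psi_hess h e (Suc i) a $ k $ l))"

section \<open>Approximation error and dependence on coordinates\<close>

lemma psi_Suc:
  "psi e (Suc (Suc i)) a = min (a $ e (Suc (Suc i))) (psi e (Suc i) a)"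
proof -
  have "{1..Suc (Suc i)} = insert (Suc (Suc i)) {1..Suc i}" by auto
  then show ?thesis by (simp add: psi_def)
qed

text \<open>Since \<open>min x y = x - max (x - y) 0\<close>, replacing the positive part by
  \<open>h\<close> costs at most \<epsilon>. The previous error is passed on without growth because
  the minimum is 1-Lipschitz in \<open>y\<close>.\<close>

lemma psi_eps_error:
  assumes "\<And>x. \<bar>max x 0 - h x\<bar> \<le> \<epsilon>"
  shows "\<bar>psi_eps h e (Suc i) a - psi e (Suc i) a\<bar> \<le> real i * \<epsilon>"
proof (induction i)
  case 0
  show ?case by (simp add: psi_def)
next
  case (Suc i)
  then show ?case
    using assms[of "a $ e (Suc (Suc i)) - psi_eps h e (Suc i) a"]
    by (simp add: psi_Suc ring_distribs max_def min_def abs_if split: if_splits)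
qed

text \<open>Supplies the invariance along a basis vector that \<open>AE_shear\<close>
  requires.\<close>

lemma psi_eps_shift:
  "k \<notin> e ` {1..i} \<Longrightarrow> psi_eps h e i (a + t *\<^sub>R axis k 1) = psi_eps h e i a"
  by (induction h e i a rule: psi_eps.induct) (auto simp: axis_def image_iff Ball_def)

lemma partial_deriv_gradient:
  assumes "(f has_derivative (\<lambda>v. G \<bullet> v)) (at a)"
  shows "((\<lambda>t. f (a + t *\<^sub>R axis k 1)) has_real_derivative G $ k) (at 0)"
proof -
  have "((\<lambda>t. a + t *\<^sub>R axis k 1) has_derivative (\<lambda>t. t *\<^sub>R axis k 1)) (at 0)"
    by (intro derivative_eq_intros | simp)+
  then have "((\<lambda>t. f (a + t *\<^sub>R axis k 1)) has_derivative (\<lambda>t. G \<bullet> (t *\<^sub>R axis k 1))) (at 0)"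
    by (rule has_derivative_compose) (use assms in simp)
  then show ?thesis
    unfolding has_field_derivative_def
    by (rule has_derivative_eq_rhs) (simp add: fun_eq_iff inner_axis)
qed

text \<open>The action on a vector of one step of the Hessian recursion, with \<open>s\<close> and
  \<open>c\<close> standing for the second and first derivative of the smoothing function.\<close>

lemma rank_one_update_mult:
  fixes v b :: "real ^ 'n" and H :: "real ^ 'n ^ 'n"
  shows "(\<chi> k l. - s * v $ k * v $ l + c * H $ k $ l) *v b = - (s * (v \<bullet> b)) *\<^sub>R v + c *\<^sub>R (H *v b)"
proof -
  have "(\<Sum>l\<in>UNIV. (- s * v $ k * v $ l + c * H $ k $ l) * b $ l) =
      - s * (\<Sum>l\<in>UNIV. v $ l * b $ l) * v $ k + c * (\<Sum>l\<in>UNIV. H $ k $ l * b $ l)" for k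
    by (simp add: sum_distrib_left sum_distrib_right algebra_simps sum.distrib sum_subtractf sum_negf)
  then show ?thesis
    by (simp add: vec_eq_iff matrix_vector_mult_def inner_vec_def)
qed

section \<open>Gradient estimates and regularity for a fixed smoothing function\<close>

context
  fixes h :: "real \<Rightarrow> real" and e :: "nat \<Rightarrow> 'n::finite" and L :: real
  assumes h_deriv: "\<And>x. (h has_real_derivative deriv h x) (at x)"
    and h_lip: "L-lipschitz_on UNIV (deriv h)"
    and h_range: "\<And>x. deriv h x \<in> {0..1}"
begin

lemma psi_eps_has_derivative:
  "(psi_eps h e (Suc i) has_derivative (\<lambda>v. psi_grad h e (Suc i) a \<bullet> v)) (at a)"
proof (induction i)
  case 0
  have "((\<lambda>a. a $ e 1) has_derivative (\<lambda>v. v $ e 1)) (at a)"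
    by (rule bounded_linear_imp_has_derivative[OF bounded_linear_vec_nth])
  moreover have "psi_eps h e (Suc 0) = (\<lambda>a. a $ e 1)" by auto
  ultimately show ?case by (simp add: inner_axis')
next
  case (Suc i)
  let ?m = "e (Suc (Suc i))"
  let ?u = "\<lambda>a. a $ ?m - psi_eps h e (Suc i) a"
  have nth: "((\<lambda>a. a $ ?m) has_derivative (\<lambda>v. v $ ?m)) (at a)"
    by (rule bounded_linear_imp_has_derivative[OF bounded_linear_vec_nth])
  have u: "(?u has_derivative (\<lambda>v. v $ ?m - psi_grad h e (Suc i) a \<bullet> v)) (at a)"
    by (intro has_derivative_diff nth Suc)
  have "((\<lambda>a. h (?u a)) has_derivative
      (\<lambda>v. (v $ ?m - psi_grad h e (Suc i) a \<bullet> v) * deriv h (?u a))) (at a)"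
    using has_derivative_compose[OF u, of h] h_deriv[of "?u a"]
    by (simp add: has_field_derivative_def mult.commute)
  with nth have "((\<lambda>a. a $ ?m - h (?u a)) has_derivative
      (\<lambda>v. v $ ?m - (v $ ?m - psi_grad h e (Suc i) a \<bullet> v) * deriv h (?u a))) (at a)"
    by (rule has_derivative_diff)
  moreover have "psi_eps h e (Suc (Suc i)) = (\<lambda>a. a $ ?m - h (?u a))" by auto
  ultimately show ?case
    by (simp add: inner_diff_left inner_axis' mult.commute)
qed

lemma psi_grad_nonneg: "psi_grad h e (Suc i) a $ k \<ge> 0"
proof (induction i)
  case 0
  show ?case by (simp add: axis_def)
next
  case (Suc i)
  define c where "c = deriv h (a $ e (Suc (Suc i)) - psi_eps h e (Suc i) a)"
  have c: "0 \<le> c" "c \<le> 1" using h_range by (auto simp: c_def)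
  have "psi_grad h e (Suc (Suc i)) a $ k =
      (1 - c) * axis (e (Suc (Suc i))) 1 $ k + c * psi_grad h e (Suc i) a $ k"
    by (simp add: c_def algebra_simps)
  then show ?case using c Suc by (simp add: axis_def)
qed

lemma sum_psi_grad: "(\<Sum>k\<in>UNIV. psi_grad h e (Suc i) a $ k) = 1"
proof (induction i)
  case 0 show ?case by (simp add: axis_def)
next
  case (Suc i)
  have "(\<Sum>k\<in>UNIV. axis (e (Suc (Suc i))) (1::real) $ k) = 1" by (simp add: axis_def)
  then show ?case using Suc
    by (simp add: sum_subtractf flip: sum_distrib_left)
qed

lemma norm_psi_grad_le: "norm (psi_grad h e (Suc i) a) \<le> 1"
  using norm_le_l1_cart[of "psi_grad h e (Suc i) a"] by (simp add: psi_grad_nonneg sum_psi_grad)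

text \<open>Expanding the square gives \<open>1 - 2 p + q\<close>, where \<open>p \<ge> 0\<close> is
  an entry of the gradient and \<open>q \<le> 1\<close> its squared norm. This is the origin of the
  factor 2 in the Hessian bounds.\<close>

lemma norm_axis_minus_psi_grad_le: "(norm (axis k 1 - psi_grad h e (Suc i) a))\<^sup>2 \<le> 2"
proof -
  have "(norm (axis k 1 - psi_grad h e (Suc i) a))\<^sup>2 =
      1 - 2 * psi_grad h e (Suc i) a $ k + (norm (psi_grad h e (Suc i) a))\<^sup>2"
    by (simp add: power2_norm_eq_inner inner_diff_left inner_diff_right inner_axis inner_axis')
  moreover have "(norm (psi_grad h e (Suc i) a))\<^sup>2 \<le> 1"
    using norm_psi_grad_le[of i a] by (simp add: abs_square_le_1)
  ultimately show ?thesis using psi_grad_nonneg[of i a k] by linarith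
qed

lemma psi_eps_lipschitz: "1-lipschitz_on UNIV (psi_eps h e (Suc i))"
proof (rule bounded_derivative_imp_lipschitz)
  show "(psi_eps h e (Suc i) has_derivative (\<lambda>v. psi_grad h e (Suc i) a \<bullet> v)) (at a within UNIV)" for a
    using psi_eps_has_derivative by simp
  show "onorm (\<lambda>v. psi_grad h e (Suc i) a \<bullet> v) \<le> 1" for a
  proof (rule onorm_le)
    fix v
    have "\<bar>psi_grad h e (Suc i) a \<bullet> v\<bar> \<le> norm (psi_grad h e (Suc i) a) * norm v"
      by (rule Cauchy_Schwarz_ineq2)
    also have "\<dots> \<le> 1 * norm v"
      using norm_psi_grad_le by (rule mult_right_mono) simp
    finally show "norm (psi_grad h e (Suc i) a \<bullet> v) \<le> 1 * norm v" by simp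
  qed
qed auto

text \<open>The variable part of the gradient is a product of the bounded Lipschitz factors
  \<open>c\<close>, with values in [0,1], and \<open>V\<close>, of norm at most 2.\<close>

lemma psi_grad_lipschitz: "\<exists>K. K-lipschitz_on UNIV (psi_grad h e (Suc i))"
proof (induction i)
  case 0
  have "psi_grad h e (Suc 0) = (\<lambda>a. axis (e 1) 1)" by auto
  then show ?case using lipschitz_on_constant by metis
next
  case (Suc i)
  then obtain K where K: "K-lipschitz_on UNIV (psi_grad h e (Suc i))" by blast
  let ?m = "e (Suc (Suc i))"
  define c where "c a = deriv h (a $ ?m - psi_eps h e (Suc i) a)" for a
  define V where "V a = axis ?m 1 - psi_grad h e (Suc i) a" for a
  have eq: "psi_grad h e (Suc (Suc i)) = (\<lambda>a. axis ?m 1 - c a *\<^sub>R V a)"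
    by (auto simp: c_def V_def)
  have V: "norm (V x - V y) \<le> K * norm (x - y)" for x y
    using lipschitz_on_normD[OF K, of y x] by (simp add: V_def norm_minus_commute)
  have V2: "norm (V x) \<le> 2" for x
    using norm_triangle_ineq4[of "axis ?m (1::real)" "psi_grad h e (Suc i) x"] norm_psi_grad_le[of i x]
    by (simp add: V_def)
  \<comment> \<open>The factor 2 arises because the argument of \<open>deriv h\<close> is a
    difference of two 1-Lipschitz functions.\<close>
  have c: "\<bar>c x - c y\<bar> \<le> 2 * L * norm (x - y)" for x y
  proof -
    have "\<bar>(x $ ?m - psi_eps h e (Suc i) x) - (y $ ?m - psi_eps h e (Suc i) y)\<bar> \<le> 2 * norm (x - y)"
      using component_le_norm_cart[of "x - y" ?m] lipschitz_on_normD[OF psi_eps_lipschitz[of i], of x y]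
      by (simp add: abs_if split: if_splits)
    then have "L * \<bar>(x $ ?m - psi_eps h e (Suc i) x) - (y $ ?m - psi_eps h e (Suc i) y)\<bar>
        \<le> L * (2 * norm (x - y))"
      using lipschitz_on_nonneg[OF h_lip] by (rule mult_left_mono)
    then show ?thesis
      using lipschitz_on_normD[OF h_lip, of "x $ ?m - psi_eps h e (Suc i) x" "y $ ?m - psi_eps h e (Suc i) y"]
      unfolding c_def real_norm_def by simp
  qed
  \<comment> \<open>The summand \<open>K\<close> is the constant of \<open>V\<close> times the bound
    1 on \<open>c\<close>; \<open>4 * L\<close> is the constant \<open>2 * L\<close> of
    \<open>c\<close> times the bound 2 on \<open>V\<close>.\<close>
  have "(K + 4 * L)-lipschitz_on UNIV (psi_grad h e (Suc (Suc i)))"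
    unfolding eq
  proof (rule lipschitz_onI)
    fix x y :: "real ^ 'n"
    have "dist (axis ?m 1 - c x *\<^sub>R V x) (axis ?m 1 - c y *\<^sub>R V y)
        = norm (c x *\<^sub>R (V x - V y) + (c x - c y) *\<^sub>R V y)"
      by (simp add: dist_norm algebra_simps norm_minus_commute)
    also have "\<dots> \<le> \<bar>c x\<bar> * norm (V x - V y) + \<bar>c x - c y\<bar> * norm (V y)"
      by (metis norm_scaleR norm_triangle_ineq)
    also have "\<dots> \<le> 1 * (K * norm (x - y)) + (2 * L * norm (x - y)) * 2"
      using h_range lipschitz_on_nonneg[OF h_lip]
      by (intro add_mono mult_mono V V2 c) (auto simp: c_def)
    finally show "dist (axis ?m 1 - c x *\<^sub>R V x) (axis ?m 1 - c y *\<^sub>R V y) \<le> (K + 4 * L) * dist x y"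
      by (simp add: dist_norm algebra_simps)
  qed (use lipschitz_on_nonneg[OF K] lipschitz_on_nonneg[OF h_lip] in simp)
  then show ?case by blast
qed

text \<open>Identifying a vector with the functional it induces does not increase distances, so the
  derivative inherits the Lipschitz constant of the gradient. That constant is global, and the
  radius 1 is arbitrary.\<close>

lemma C11_loc_psi_eps: "C11_loc (psi_eps h e (Suc i))"
  unfolding C11_loc_def
proof (rule exI[of _ "\<lambda>a. blinfun_inner_left (psi_grad h e (Suc i) a)"], intro conjI allI)
  obtain K where K: "K-lipschitz_on UNIV (psi_grad h e (Suc i))" using psi_grad_lipschitz by blast
  show "(psi_eps h e (Suc i) has_derivative blinfun_inner_left (psi_grad h e (Suc i) x)) (at x)" for x
    using psi_eps_has_derivative[of i x] by (simp add: inner_commute)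
  show "\<exists>r>0. \<exists>L. L-lipschitz_on (ball x r) (\<lambda>a. blinfun_inner_left (psi_grad h e (Suc i) a))" for x
  proof (intro exI conjI)
    show "K-lipschitz_on (ball x 1) (\<lambda>a. blinfun_inner_left (psi_grad h e (Suc i) a))"
    proof (rule lipschitz_onI)
      fix y z
      have "dist (blinfun_inner_left (psi_grad h e (Suc i) y)) (blinfun_inner_left (psi_grad h e (Suc i) z))
        \<le> norm (psi_grad h e (Suc i) y - psi_grad h e (Suc i) z)"
        unfolding dist_norm
        by (rule norm_blinfun_bound)
          (auto simp: blinfun.diff_left inner_diff_right[symmetric] Cauchy_Schwarz_ineq2 mult.commute)
      also have "\<dots> \<le> K * dist y z" using lipschitz_onD[OF K, of y z] by (simp add: dist_norm)
      finally show "dist (blinfun_inner_left (psi_grad h e (Suc i) y)) (blinfun_inner_left (psi_grad h e (Suc i) z))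
        \<le> K * dist y z" .
    qed (rule lipschitz_on_nonneg[OF K])
  qed simp
qed

section \<open>Partial derivatives and the Hessian\<close>

lemma partial_psi_eps:
  "((\<lambda>t. psi_eps h e (Suc i) (a + t *\<^sub>R axis k 1)) has_real_derivative psi_grad h e (Suc i) a $ k) (at 0)"
  by (rule partial_deriv_gradient[OF psi_eps_has_derivative])

lemma partial_deriv_psi_eps: "partial_deriv k (psi_eps h e (Suc i)) a = psi_grad h e (Suc i) a $ k"
  unfolding partial_deriv_def by (rule DERIV_imp_deriv[OF partial_psi_eps])

text \<open>The chain and product rules apply at each level of the recursion. With
  \<open>Suc i\<close> entries there are \<open>i\<close> levels, and level \<open>j\<close>
  evaluates \<open>deriv h\<close> at the argument belonging to entry \<open>j + 2\<close>.\<close>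

lemma partial_psi_grad:
  assumes "\<And>j. j < i \<Longrightarrow> deriv h differentiable (at (a $ e (Suc (Suc j)) - psi_eps h e (Suc j) a))"
  shows "((\<lambda>t. psi_grad h e (Suc i) (a + t *\<^sub>R axis k 1) $ l) has_real_derivative
    psi_hess h e (Suc i) a $ k $ l) (at 0)"
  using assms
proof (induction i)
  case 0 then show ?case by simp
next
  case (Suc i)
  let ?m = "e (Suc (Suc i))"
  define u where "u t = (a + t *\<^sub>R axis k 1) $ ?m - psi_eps h e (Suc i) (a + t *\<^sub>R axis k 1)" for t
  define v where "v = axis ?m 1 - psi_grad h e (Suc i) a"
  have u: "(u has_real_derivative v $ k) (at 0)"
  proof -
    have "((\<lambda>t. a $ ?m + t * axis k 1 $ ?m) has_real_derivative axis k 1 $ ?m) (at 0)"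
      by (auto intro!: derivative_eq_intros)
    moreover have "axis k (1::real) $ ?m = axis ?m 1 $ k" by (simp add: axis_def)
    ultimately show ?thesis
      unfolding u_def v_def using DERIV_diff[OF _ partial_psi_eps[of i a k]] by simp
  qed
  have "deriv h differentiable (at (u 0))" using Suc.prems[of i] by (simp add: u_def)
  then have d: "(deriv h has_real_derivative deriv (deriv h) (u 0)) (at (u 0))"
    using DERIV_deriv_iff_real_differentiable by blast
  have "((\<lambda>t. deriv h (u t)) has_real_derivative deriv (deriv h) (u 0) * v $ k) (at 0)"
    by (rule DERIV_chain2[OF d u])
  moreover have "((\<lambda>t. psi_grad h e (Suc i) (a + t *\<^sub>R axis k 1) $ l) has_real_derivative
      psi_hess h e (Suc i) a $ k $ l) (at 0)"
    by (rule Suc.IH) (use Suc.prems in simp)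
  ultimately have "((\<lambda>t. axis ?m 1 $ l - deriv h (u t) *
      (axis ?m 1 $ l - psi_grad h e (Suc i) (a + t *\<^sub>R axis k 1) $ l)) has_real_derivative
      0 - (deriv (deriv h) (u 0) * v $ k * (axis ?m 1 $ l - psi_grad h e (Suc i) (a + 0 *\<^sub>R axis k 1) $ l)
        + (0 - psi_hess h e (Suc i) a $ k $ l) * deriv h (u 0))) (at 0)"
    by (intro DERIV_diff DERIV_mult DERIV_const)
  then show ?case
    by (simp add: u_def v_def Let_def algebra_simps)
qed

lemma psi_hess_Suc_mult:
  "psi_hess h e (Suc (Suc i)) a *v b =
    (let m = e (Suc (Suc i)); u = a $ m - psi_eps h e (Suc i) a; v = axis m 1 - psi_grad h e (Suc i) a in
      - (deriv (deriv h) u * (v \<bullet> b)) *\<^sub>R v + deriv h u *\<^sub>R (psi_hess h e (Suc i) a *v b))"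
  by (simp only: psi_hess.simps Let_def rank_one_update_mult)

text \<open>Each level adds a rank-one term whose quadratic form lies between
  \<open>-2 M |b|^2\<close> and 0, and multiplies the previous matrix by a factor in [0,1]. The norm
  bound is carried along separately, by the triangle inequality.\<close>

lemma psi_hess_bounds:
  assumes "\<And>j. j < i \<Longrightarrow> 0 \<le> deriv (deriv h) (a $ e (Suc (Suc j)) - psi_eps h e (Suc j) a) \<and>
    deriv (deriv h) (a $ e (Suc (Suc j)) - psi_eps h e (Suc j) a) \<le> M"
  shows "b \<bullet> (psi_hess h e (Suc i) a *v b) \<le> 0 \<and>
    - (2 * real i * M) * (norm b)\<^sup>2 \<le> b \<bullet> (psi_hess h e (Suc i) a *v b) \<and>
    norm (psi_hess h e (Suc i) a *v b) \<le> 2 * real i * M * norm b"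
  using assms
proof (induction i)
  case 0 then show ?case by simp
next
  case (Suc i)
  define u where "u = a $ e (Suc (Suc i)) - psi_eps h e (Suc i) a"
  define v where "v = axis (e (Suc (Suc i))) 1 - psi_grad h e (Suc i) a"
  define s where "s = deriv (deriv h) u"
  define c where "c = deriv h u"
  define w where "w = psi_hess h e (Suc i) a *v b"
  define B where "B = 2 * real i * M"
  have s: "0 \<le> s" "s \<le> M" using Suc.prems[of i] by (auto simp: s_def u_def)
  have c: "0 \<le> c" "c \<le> 1" using h_range[of u] by (auto simp: c_def)
  have v: "norm v * norm v \<le> 2" using norm_axis_minus_psi_grad_le by (simp add: v_def power2_eq_square)
  have IH: "b \<bullet> w \<le> 0" "- B * (norm b)\<^sup>2 \<le> b \<bullet> w" "norm w \<le> B * norm b"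
    using Suc.IH Suc.prems unfolding w_def B_def by auto
  have B: "B \<ge> 0" using s by (simp add: B_def)
  have eq: "psi_hess h e (Suc (Suc i)) a *v b = - (s * (v \<bullet> b)) *\<^sub>R v + c *\<^sub>R w"
    unfolding psi_hess_Suc_mult Let_def s_def c_def w_def u_def v_def by simp
  have vb: "\<bar>v \<bullet> b\<bar> \<le> norm v * norm b" by (rule Cauchy_Schwarz_ineq2)
  have "(v \<bullet> b)\<^sup>2 \<le> (norm v * norm b)\<^sup>2" using vb by (metis abs_ge_zero power2_abs power_mono)
  also have "\<dots> = (norm v * norm v) * (norm b)\<^sup>2" by (simp add: power2_eq_square)
  also have "\<dots> \<le> 2 * (norm b)\<^sup>2" using v by (intro mult_right_mono) auto
  finally have vb2: "(v \<bullet> b)\<^sup>2 \<le> 2 * (norm b)\<^sup>2" .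
  have inner: "b \<bullet> (psi_hess h e (Suc (Suc i)) a *v b) = - (s * (v \<bullet> b)\<^sup>2) + c * (b \<bullet> w)"
    unfolding eq by (simp add: inner_add_right inner_diff_right inner_commute power2_eq_square)
  have "s * (v \<bullet> b)\<^sup>2 \<le> M * (2 * (norm b)\<^sup>2)" using s vb2 by (intro mult_mono) auto
  moreover have "- B * (norm b)\<^sup>2 \<le> c * (b \<bullet> w)"
  proof -
    \<comment> \<open>As the form is nonpositive, a factor in [0,1] can only raise its
      value.\<close>
    have "b \<bullet> w \<le> c * (b \<bullet> w)" using c IH(1) mult_right_mono_neg[of c 1 "b \<bullet> w"] by simp
    then show ?thesis using IH(2) by linarith
  qed
  ultimately have lower: "- (2 * real (Suc i) * M) * (norm b)\<^sup>2 \<le> b \<bullet> (psi_hess h e (Suc (Suc i)) a *v b)"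
    unfolding inner by (simp add: B_def algebra_simps)
  have upper: "b \<bullet> (psi_hess h e (Suc (Suc i)) a *v b) \<le> 0"
    unfolding inner using mult_nonneg_nonneg[OF s(1), of "(v \<bullet> b)\<^sup>2"] mult_nonneg_nonpos[OF c(1) IH(1)]
    by simp
  have "norm (- (s * (v \<bullet> b)) *\<^sub>R v + c *\<^sub>R w) \<le> s * \<bar>v \<bullet> b\<bar> * norm v + c * norm w"
    using norm_triangle_ineq[of "- (s * (v \<bullet> b)) *\<^sub>R v" "c *\<^sub>R w"] s c by (simp add: abs_mult)
  also have "\<dots> \<le> s * (norm v * norm b) * norm v + 1 * (B * norm b)"
    using s c vb IH(3) B by (intro add_mono mult_mono) auto
  \<comment> \<open>Collecting the two factors \<open>norm v\<close> makes the bound on the squared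
    norm applicable.\<close>
  also have "s * (norm v * norm b) * norm v = s * (norm v * norm v) * norm b" by simp
  also have "\<dots> \<le> M * 2 * norm b"
    using s v by (intro mult_right_mono mult_mono) auto
  finally have "norm (psi_hess h e (Suc (Suc i)) a *v b) \<le> 2 * real (Suc i) * M * norm b"
    unfolding eq B_def by (simp add: algebra_simps)
  with lower upper show ?case by blast
qed

text \<open>Injectivity of \<open>e\<close> keeps coordinate \<open>e (j + 2)\<close> out of those
  entering the smoothed minimum of the first \<open>j + 1\<close> entries, so each argument is a
  shear; finitely many exceptional null sets are joined.\<close>

lemma AE_psi_eps_arguments:
  assumes inj: "inj_on e {1..Suc n}" and P: "AE t in lebesgue. P t"
  shows "AE a in lebesgue. \<forall>j<n. P (a $ e (Suc (Suc j)) - psi_eps h e (Suc j) a)"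
proof -
  have P': "AE t in lborel. P t" using P by (simp only: AE_completion_iff)
  have "AE a in lebesgue. P (a $ e (Suc (Suc j)) - psi_eps h e (Suc j) a)" if "j < n" for j
  proof -
    have "e (Suc (Suc j)) \<notin> e ` {1..Suc j}"
    proof
      assume "e (Suc (Suc j)) \<in> e ` {1..Suc j}"
      then obtain x where x: "x \<in> {1..Suc j}" "e (Suc (Suc j)) = e x" by auto
      then have "Suc (Suc j) = x"
        using that by (intro inj_onD[OF inj]) auto
      then show False using x by simp
    qed
    then have "AE a in lebesgue. P (a \<bullet> axis (e (Suc (Suc j))) 1 - psi_eps h e (Suc j) a)"
      by (intro AE_shear[OF psi_eps_lipschitz _ psi_eps_shift P']) simp_all
    then show ?thesis by (simp add: inner_axis)
  qed
  then show ?thesis by (simp add: AE_ball_countable flip: lessThan_iff Ball_def)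
qed

end

text \<open>The value minus infinity is impossible because the whole space is not a null set; a
  finite norm is then a real number and an almost everywhere bound.\<close>

lemma Linf_norm_finiteE:
  assumes "Linf_norm f < \<infinity>"
  obtains M where "Linf_norm f = ereal M" "AE x in lebesgue. \<bar>f x\<bar> \<le> M"
proof -
  have ae: "AE x in lebesgue. ereal \<bar>f x\<bar> \<le> Linf_norm f"
    unfolding Linf_norm_def by (rule esssup_AE)
  have "Linf_norm f \<noteq> - \<infinity>"
  proof
    assume "Linf_norm f = - \<infinity>"
    then have "AE x in (lebesgue :: 'a measure). False" using ae by simp
    then show False by (simp add: AE_iff_null null_sets_def)
  qed
  then obtain M where M: "Linf_norm f = ereal M" using assms by (cases "Linf_norm f") auto
  then show thesis using ae that by simp
qed

section \<open>Assembly of the derivative formulas, the error estimate and the Hessian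
  bounds\<close>

theorem proposition2p2:
  fixes n :: nat
    and e :: "nat \<Rightarrow> 'n::finite"
    and g :: "real \<Rightarrow> real \<Rightarrow> real"
    and \<epsilon> :: real
  assumes "n \<ge> 2"
    and "bij_betw e {1..n} (UNIV :: 'n set)"
    and "admissible_smoothing g"
    and "\<epsilon> > 0"
  shows "C11_loc (psi_eps (g \<epsilon>) e n)
    \<and> (\<forall>a. \<forall>i\<in>{1..n}.
          partial_differentiable (e i) (psi_eps (g \<epsilon>) e n) a
        \<and> partial_differentiable (e i) (psi_eps (g \<epsilon>) e (n - 1)) a
        \<and> partial_deriv (e i) (psi_eps (g \<epsilon>) e n) a
          = kdelta i n
            - deriv (g \<epsilon>) (a $ e n - psi_eps (g \<epsilon>) e (n - 1) a)
              * (kdelta i n - partial_deriv (e i) (psi_eps (g \<epsilon>) e (n - 1)) a))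
    \<and> (AE a in lebesgue. \<forall>i\<in>{1..n}. \<forall>j\<in>{1..n}.
          partial_differentiable (e i) (partial_deriv (e j) (psi_eps (g \<epsilon>) e n)) a
        \<and> partial_differentiable (e i) (partial_deriv (e j) (psi_eps (g \<epsilon>) e (n - 1))) a
        \<and> deriv (g \<epsilon>) differentiable (at (a $ e n - psi_eps (g \<epsilon>) e (n - 1) a))
        \<and> partial_deriv (e i) (partial_deriv (e j) (psi_eps (g \<epsilon>) e n)) a
          = - deriv (deriv (g \<epsilon>)) (a $ e n - psi_eps (g \<epsilon>) e (n - 1) a)
              * (kdelta i n - partial_deriv (e i) (psi_eps (g \<epsilon>) e (n - 1)) a)
              * (kdelta j n - partial_deriv (e j) (psi_eps (g \<epsilon>) e (n - 1)) a)
            + deriv (g \<epsilon>) (a $ e n - psi_eps (g \<epsilon>) e (n - 1) a)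
              * partial_deriv (e i) (partial_deriv (e j) (psi_eps (g \<epsilon>) e (n - 1))) a)
    \<and> Linf_norm (\<lambda>a. psi_eps (g \<epsilon>) e n a - psi e n a) \<le> ereal ((real n - 1) * \<epsilon>)
    \<and> (\<forall>a. (\<forall>i\<in>{1..n}. partial_deriv (e i) (psi_eps (g \<epsilon>) e n) a \<ge> 0)
        \<and> (\<Sum>j=1..n. partial_deriv (e j) (psi_eps (g \<epsilon>) e n) a) = 1)
    \<and> (AE a in lebesgue. \<forall>b. norm b = 1 \<longrightarrow>
          - (ereal (2 * (real n - 1)) * Linf_norm (deriv (deriv (g \<epsilon>))))
            \<le> ereal (b \<bullet> (hessian (psi_eps (g \<epsilon>) e n) a *v b))
        \<and> b \<bullet> (hessian (psi_eps (g \<epsilon>) e n) a *v b) \<le> 0)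
    \<and> (AE a in lebesgue.
          ereal (onorm (\<lambda>b. hessian (psi_eps (g \<epsilon>) e n) a *v b))
            \<le> ereal (2 * (real n - 1)) * Linf_norm (deriv (deriv (g \<epsilon>))))"
proof -
  obtain m where n: "n = Suc (Suc m)"
    using \<open>n \<ge> 2\<close> by (metis add_2_eq_Suc le_Suc_ex)
  define h where "h = g \<epsilon>"
  have C11: "C11 h" and range: "\<And>x. deriv h x \<in> {0..1}"
    and h''_nonneg: "AE x in lebesgue. deriv (deriv h) x \<ge> 0"
    and close: "(SUP x. ereal \<bar>max x 0 - h x\<bar>) \<le> ereal \<epsilon>"
    and h''_finite: "Linf_norm (deriv (deriv h)) < \<infinity>"
    using assms(3,4) by (auto simp: admissible_smoothing_def h_def)
  obtain L where lip: "L-lipschitz_on UNIV (deriv h)" using C11 by (auto simp: C11_def)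
  have h_deriv: "(h has_real_derivative deriv h x) (at x)" for x
    using C11 DERIV_deriv_iff_real_differentiable by (auto simp: C11_def)
  have close: "\<bar>max x 0 - h x\<bar> \<le> \<epsilon>" for x
    using SUP_upper2[of x UNIV] close by (metis (no_types, lifting) SUP_le_iff UNIV_I ereal_less_eq(3))
  obtain M where M: "Linf_norm (deriv (deriv h)) = ereal M" "AE x in lebesgue. \<bar>deriv (deriv h) x\<bar> \<le> M"
    using Linf_norm_finiteE[OF h''_finite] .
  note h = h_deriv lip range
  have inj: "inj_on e {1..Suc (Suc m)}" and range_e: "e ` {1..Suc (Suc m)} = UNIV"
    using assms(2) by (auto simp: bij_betw_def n)
  have axis_e: "axis (e (Suc (Suc m))) (1::real) $ e i = kdelta i (Suc (Suc m))" if "i \<in> {1..Suc (Suc m)}" for i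
    using inj_onD[OF inj, of i "Suc (Suc m)"] that by (auto simp: axis_def kdelta_def)

  \<comment> \<open>Differentiability is recorded separately, since \<open>deriv (deriv h)\<close>
    has a value at every point and its bounds do not imply it.\<close>
  have "AE x in lebesgue. deriv h differentiable (at x)"
    using lipschitz_differentiable_AE[OF lip] by (rule AE_completion)
  then have "AE x in lebesgue. deriv h differentiable (at x) \<and> 0 \<le> deriv (deriv h) x \<and> deriv (deriv h) x \<le> M"
    using h''_nonneg M(2) by eventually_elim auto
  from AE_psi_eps_arguments[OF h inj this]
  have regular: "AE a in lebesgue. \<forall>j<Suc m. deriv h differentiable (at (a $ e (Suc (Suc j)) - psi_eps h e (Suc j) a))
      \<and> 0 \<le> deriv (deriv h) (a $ e (Suc (Suc j)) - psi_eps h e (Suc j) a)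
      \<and> deriv (deriv h) (a $ e (Suc (Suc j)) - psi_eps h e (Suc j) a) \<le> M" .

  have pd: "partial_deriv k (psi_eps h e (Suc i)) = (\<lambda>a. psi_grad h e (Suc i) a $ k)" for k i
    using partial_deriv_psi_eps[OF h] by blast
  have first: "partial_differentiable k (psi_eps h e (Suc i)) a" for k i a
    unfolding partial_differentiable_def
    using partial_psi_eps[OF h] real_differentiable_def by blast

  \<comment> \<open>All indices up to \<open>Suc m\<close> are covered because the recursion formula
    involves the second derivatives for both \<open>n\<close> and \<open>n - 1\<close>
    entries.\<close>
  have second: "AE a in lebesgue. \<forall>i\<le>Suc m. \<forall>k l.
      ((\<lambda>t. psi_grad h e (Suc i) (a + t *\<^sub>R axis k 1) $ l) has_real_derivative psi_hess h e (Suc i) a $ k $ l) (at 0)"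
    using regular by eventually_elim (auto intro!: partial_psi_grad[OF h])
  have hess: "AE a in lebesgue. hessian (psi_eps h e n) a = psi_hess h e n a"
    using second
  proof eventually_elim
    case (elim a)
    then have "partial_deriv k (\<lambda>a. psi_grad h e n a $ l) a = psi_hess h e n a $ k $ l" for k l
      unfolding partial_deriv_def n by (intro DERIV_imp_deriv) blast
    then show ?case
      by (simp add: n hessian_def pd vec_eq_iff del: psi_hess.simps psi_grad.simps)
  qed
  have bounds: "AE a in lebesgue. \<forall>b. b \<bullet> (hessian (psi_eps h e n) a *v b) \<le> 0 \<and>
      - (2 * real (Suc m) * M) * (norm b)\<^sup>2 \<le> b \<bullet> (hessian (psi_eps h e n) a *v b) \<and>
      norm (hessian (psi_eps h e n) a *v b) \<le> 2 * real (Suc m) * M * norm b"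
    using regular hess
  proof eventually_elim
    case (elim a)
    show ?case
      unfolding elim(2) unfolding n
    proof (rule allI, rule psi_hess_bounds[OF h])
      fix j assume "j < Suc m"
      from elim(1)[rule_format, OF this]
      show "0 \<le> deriv (deriv h) (a $ e (Suc (Suc j)) - psi_eps h e (Suc j) a) \<and>
          deriv (deriv h) (a $ e (Suc (Suc j)) - psi_eps h e (Suc j) a) \<le> M"
        by simp
    qed
  qed
  have const: "ereal (2 * (real n - 1)) * Linf_norm (deriv (deriv h)) = ereal (2 * real (Suc m) * M)"
    by (simp add: M n)

  have "C11_loc (psi_eps h e n)"
    unfolding n by (rule C11_loc_psi_eps[OF h])
  moreover have "\<forall>a. \<forall>i\<in>{1..n}.
          partial_differentiable (e i) (psi_eps h e n) a
        \<and> partial_differentiable (e i) (psi_eps h e (n - 1)) a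
        \<and> partial_deriv (e i) (psi_eps h e n) a
          = kdelta i n - deriv h (a $ e n - psi_eps h e (n - 1) a)
              * (kdelta i n - partial_deriv (e i) (psi_eps h e (n - 1)) a)"
    using first by (simp add: n pd axis_e del: psi_eps.simps)
  moreover have "AE a in lebesgue. \<forall>i\<in>{1..n}. \<forall>j\<in>{1..n}.
          partial_differentiable (e i) (partial_deriv (e j) (psi_eps h e n)) a
        \<and> partial_differentiable (e i) (partial_deriv (e j) (psi_eps h e (n - 1))) a
        \<and> deriv h differentiable (at (a $ e n - psi_eps h e (n - 1) a))
        \<and> partial_deriv (e i) (partial_deriv (e j) (psi_eps h e n)) a
          = - deriv (deriv h) (a $ e n - psi_eps h e (n - 1) a)
              * (kdelta i n - partial_deriv (e i) (psi_eps h e (n - 1)) a)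
              * (kdelta j n - partial_deriv (e j) (psi_eps h e (n - 1)) a)
            + deriv h (a $ e n - psi_eps h e (n - 1) a)
              * partial_deriv (e i) (partial_deriv (e j) (psi_eps h e (n - 1))) a"
    using second regular
  proof eventually_elim
    case (elim a)
    have d: "((\<lambda>t. psi_grad h e (Suc i) (a + t *\<^sub>R axis k 1) $ l) has_real_derivative
        psi_hess h e (Suc i) a $ k $ l) (at 0)" if "i \<le> Suc m" for i k l
      using elim(1) that by blast
    have d1: "partial_differentiable k (\<lambda>a. psi_grad h e (Suc i) a $ l) a" if "i \<le> Suc m" for i k l
      unfolding partial_differentiable_def using d[OF that] real_differentiable_def by blast
    have d2: "partial_deriv k (\<lambda>a. psi_grad h e (Suc i) a $ l) a = psi_hess h e (Suc i) a $ k $ l"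
      if "i \<le> Suc m" for i k l
      unfolding partial_deriv_def using d[OF that] by (rule DERIV_imp_deriv)
    have d3: "deriv h differentiable (at (a $ e (Suc (Suc m)) - psi_eps h e (Suc m) a))"
      using elim(2) by blast
    show ?case
      unfolding n diff_Suc_1 pd using d1 d2 d3
      by (simp add: axis_e Let_def del: psi_eps.simps psi_grad.simps)
  qed
  moreover have "Linf_norm (\<lambda>a. psi_eps h e n a - psi e n a) \<le> ereal ((real n - 1) * \<epsilon>)"
    unfolding Linf_norm_def
  proof (rule esssup_I)
    \<comment> \<open>The bound on the essential supremum requires measurability: the smoothed
      minimum is continuous, and the exact one is an iterated minimum of coordinates.\<close>
    have "continuous_on UNIV (psi_eps h e n)"
      unfolding n by (rule lipschitz_on_continuous_on[OF psi_eps_lipschitz[OF h]])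
    then have "psi_eps h e n \<in> borel_measurable borel" by (rule borel_measurable_continuous_onI)
    moreover have "psi e (Suc i) \<in> borel_measurable borel" for i
    proof (induction i)
      case 0
      have "psi e (Suc 0) = (\<lambda>a. a $ e 1)" by (auto simp: psi_def)
      then show ?case by simp
    next
      case (Suc i)
      have "psi e (Suc (Suc i)) = (\<lambda>a. min (a $ e (Suc (Suc i))) (psi e (Suc i) a))"
        using psi_Suc by blast
      then show ?case using Suc by simp
    qed
    ultimately have "(\<lambda>a. ereal \<bar>psi_eps h e n a - psi e n a\<bar>) \<in> borel_measurable lborel"
      unfolding n by measurable
    then show "(\<lambda>a. ereal \<bar>psi_eps h e n a - psi e n a\<bar>) \<in> borel_measurable lebesgue"
      by (rule measurable_completion)
    show "AE a in lebesgue. ereal \<bar>psi_eps h e n a - psi e n a\<bar> \<le> ereal ((real n - 1) * \<epsilon>)"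
      using psi_eps_error[of h \<epsilon> e "Suc m"] close by (simp add: n del: psi_eps.simps)
  qed
  moreover have "\<forall>a. (\<forall>i\<in>{1..n}. partial_deriv (e i) (psi_eps h e n) a \<ge> 0)
        \<and> (\<Sum>j=1..n. partial_deriv (e j) (psi_eps h e n) a) = 1"
  proof (intro allI conjI)
    fix a
    show "\<forall>i\<in>{1..n}. partial_deriv (e i) (psi_eps h e n) a \<ge> 0"
      unfolding n pd using psi_grad_nonneg[OF h] by blast
    \<comment> \<open>The bijection \<open>e\<close> turns the sum over positions into a sum over
      all coordinates.\<close>
    have "(\<Sum>j=1..n. partial_deriv (e j) (psi_eps h e n) a) = (\<Sum>k\<in>UNIV. psi_grad h e n a $ k)"
      unfolding n pd using inj range_e sum.reindex[of e "{1..Suc (Suc m)}" "\<lambda>k. psi_grad h e (Suc (Suc m)) a $ k"]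
      by (simp del: psi_grad.simps)
    then show "(\<Sum>j=1..n. partial_deriv (e j) (psi_eps h e n) a) = 1"
      unfolding n by (simp only: sum_psi_grad[OF h])
  qed
  moreover have "AE a in lebesgue. \<forall>b. norm b = 1 \<longrightarrow>
          - (ereal (2 * (real n - 1)) * Linf_norm (deriv (deriv h)))
            \<le> ereal (b \<bullet> (hessian (psi_eps h e n) a *v b))
        \<and> b \<bullet> (hessian (psi_eps h e n) a *v b) \<le> 0"
    unfolding const using bounds
  proof eventually_elim
    case (elim a)
    show ?case
    proof (intro allI impI)
      fix b :: "real ^ 'n" assume "norm b = 1"
      with elim[rule_format, of b] show
        "- ereal (2 * real (Suc m) * M) \<le> ereal (b \<bullet> (hessian (psi_eps h e n) a *v b))
          \<and> b \<bullet> (hessian (psi_eps h e n) a *v b) \<le> 0"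
        by (simp del: of_nat_Suc)
    qed
  qed
  moreover have "AE a in lebesgue.
          ereal (onorm (\<lambda>b. hessian (psi_eps h e n) a *v b))
            \<le> ereal (2 * (real n - 1)) * Linf_norm (deriv (deriv h))"
    unfolding const using bounds
  proof eventually_elim
    case (elim a)
    then have "onorm (\<lambda>b. hessian (psi_eps h e n) a *v b) \<le> 2 * real (Suc m) * M"
      by (intro onorm_le) blast
    then show ?case by simp
  qed
  ultimately show ?thesis
    unfolding h_def by blast
qed

end
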